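(* For all $n\in\mathbb{N}$ with $n\ge1$ and all $X\in\mathrm{IS}$: if $X\in\mathcal{E}_n$, then $X$ computes $\mathrm{tstnz}_n$.
   Context: Basic instructions: $\mathtt{in}{:}i.\mathtt{get}$ ($i\ge1$), $\mathtt{out}.\mathtt{set}{:}b$ ($b\in\{0,1\}$), $\mathtt{aux}{:}i.\mathtt{get}$ ($i\ge1$), $\mathtt{aux}{:}i.\mathtt{set}{:}b$ ($i\ge1$, $b\in\{0,1\}$). The part before the dot names a Boolean register ($\mathtt{in}{:}i$ input, $\mathtt{out}$ output, $\mathtt{aux}{:}i$ auxiliary); $\mathtt{get}$ changes nothing and replies the content, $\mathtt{set}{:}b$ makes the content $b$ and replies $b$. Primitive instructions: for each basic instruction $a$, plain $a$, positive test $+a$, negative test $-a$; forward jumps $\#l$ ($l\in\mathbb{N}$); termination $!$. $\mathrm{IS}$ is the set of finite sequences $X=u_1;\dots;u_k$ of primitive instructions, $\mathrm{len}(X)=k$. Execution starts at $u_1$: plain $a$ executes $a$ and proceeds with the next instruction; $+a$ executes $a$ and proceeds with the next instruction if the reply is $1$, otherwise skips the next one and proceeds with the one after it; $-a$ likewise with replies reversed; $\#l$ proceeds with the $l$-th next instruction; $!$ terminates. If $l=0$ or there is no instruction to proceed with, execution never terminates. For $f:\{0,1\}^n\to\{0,1\}$, $X$ computes $f$ if there is $k$ such that for all $b_1,\dots,b_n$, executing $X$ with $\mathtt{in}{:}i$ initially $b_i$, $\mathtt{out}$ and $\mathtt{aux}{:}1,\dots,\mathtt{aux}{:}k$ initially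 $0$ (other registers arbitrary) terminates with final content of $\mathtt{out}$ equal to $f(b_1,\dots,b_n)$. $\mathrm{tstnz}_n(b_1,\dots,b_n)=1$ iff some $b_i=1$. Read instructions are $+\mathtt{in}{:}i.\mathtt{get}$ and $-\mathtt{in}{:}i.\mathtt{get}$; such an instruction reads $\mathtt{in}{:}i$; an input register is read $t$ times in $X$ if it is read by exactly $t$ occurrences of read instructions in $X$. Notation: $;_{i=p}^{q}P_i$ denotes $P_p;\dots;P_q$ (empty if $p>q$); write $r_i$ for $\mathtt{in}{:}i.\mathtt{get}$. The set $\mathcal{C}_n$: for even $n$, $X\in\mathcal{C}_n$ iff $X={;}_{i=1}^{n/2}\big(-r_{\rho(2i-1)};+r_{\rho(2i)};\varphi(i)\big);!$ for some bijection $\rho$ of $\{1,\dots,n\}$ and function $\varphi$ on $\{1,\dots,n/2\}$ with $\varphi(j)\in\{\#3k: k\ge1, k\le n/2-j\}\cup\{\mathtt{out}.\mathtt{set}{:}1,+\mathtt{out}.\mathtt{set}{:}1,-\mathtt{out}.\mathtt{set}{:}1\}$ for all $j$ and $\varphi(n/2)\in\{\mathtt{out}.\mathtt{set}{:}1,+\mathtt{out}.\mathtt{set}{:}1\}$; for odd $n$, $X\in\mathcal{C}_n$ iff there are $m\in\mathbb{N}$ with $m\le(n-1)/2$, a bijection $\rho$ of $\{1,\dots,n\}$ and $\varphi$ on $\{1,\dots,(n+1)/2\}$ with $X={;}_{i=1}^{m}\big(-r_{\rho(2i-1)};+r_{\rho(2i)};\varphi(i)\big);+r_{\rho(2m+1)};\varphi(m+1);{;}_{i=m+1}^{(n-1)/2}\big(-r_{\rho(2i)};+r_{\rho(2i+1)};\varphi(i+1)\big);!$,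 where $\varphi(j)\in\{\#(3k-1): k\ge1, k\le(n+1)/2-j, j\le m<j+k\}\cup\{\#3k: k\ge1, k\le(n+1)/2-j, \text{not }(j\le m<j+k)\}\cup\{\mathtt{out}.\mathtt{set}{:}1,+\mathtt{out}.\mathtt{set}{:}1,-\mathtt{out}.\mathtt{set}{:}1\}$ for all $j$ and $\varphi((n+1)/2)\in\{\mathtt{out}.\mathtt{set}{:}1,+\mathtt{out}.\mathtt{set}{:}1\}$. A chain of zero or more forward jumps in $X$ beginning at position $p$ leads to position $q$ if there are positions $p=p_0,p_1,\dots,p_s=q$ ($s\ge0$) such that for each $t<s$ the $p_t$-th instruction of $X$ is $\#l_t$ with $l_t\ge1$ and $p_{t+1}=p_t+l_t$. The set $\mathcal{E}_n\subseteq\mathrm{IS}$: if no input register is read more than once in $X$, then $X\in\mathcal{E}_n$ iff $X\in\mathcal{C}_n$; if at least two input registers are read more than once in $X$, or some input register is read more than twice in $X$, then $X\notin\mathcal{E}_n$; if exactly one input register is read more than once in $X$ and it is read exactly twice, then $X\in\mathcal{E}_n$ iff, for positions $k\neq l$ such that the $k$-th and $l$-th primitive instructions of $X$ read that same input register: (a) no chain of zero or more forward jumps in $X$ beginning at a position $\le k+2$ leads to position $l$; (b) the $l$-th primitive instruction of $X$ is $+\mathtt{in}{:}i.\mathtt{get}$ for some $i\le n$; (c) the sequence obtained from $X$ by replacing its $l$-th primitive instruction by $\#2$ belongs to $\mathcal{C}_n$. *)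

theory Defs
  imports Main
begin

text \<open>The bits 0 and 1 are rendered as \<^term>\<open>False\<close> and \<^term>\<open>True\<close>; instruction positions
  are counted from 1.\<close>

datatype register = In nat | Out | Aux nat

type_synonym state = "register \<Rightarrow> bool"

datatype basic = InGet nat | OutSet bool | AuxGet nat | AuxSet nat bool

datatype instr = Plain basic | Pos basic | Neg basic | Jump nat | Halt

fun valid_basic :: "basic \<Rightarrow> bool" where
  "valid_basic (InGet i) \<longleftrightarrow> i \<ge> 1"
| "valid_basic (OutSet b) \<longleftrightarrow> True"
| "valid_basic (AuxGet i) \<longleftrightarrow> i \<ge> 1"
| "valid_basic (AuxSet i b) \<longleftrightarrow> i \<ge> 1"

fun valid_instr :: "instr \<Rightarrow> bool" where
  "valid_instr (Plain a) \<longleftrightarrow> valid_basic a"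
| "valid_instr (Pos a) \<longleftrightarrow> valid_basic a"
| "valid_instr (Neg a) \<longleftrightarrow> valid_basic a"
| "valid_instr (Jump l) \<longleftrightarrow> True"
| "valid_instr Halt \<longleftrightarrow> True"

definition IS :: "instr list set" where
  "IS = {X. \<forall>u\<in>set X. valid_instr u}"

definition instr_at :: "instr list \<Rightarrow> nat \<Rightarrow> instr \<Rightarrow> bool" where
  "instr_at X p u \<longleftrightarrow> 1 \<le> p \<and> p \<le> length X \<and> X ! (p - 1) = u"

fun reply :: "basic \<Rightarrow> state \<Rightarrow> bool" where
  "reply (InGet i) s = s (In i)"
| "reply (OutSet b) s = b"
| "reply (AuxGet i) s = s (Aux i)"
| "reply (AuxSet i b) s = b"

fun effect :: "basic \<Rightarrow> state \<Rightarrow> state" where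
  "effect (InGet i) s = s"
| "effect (OutSet b) s = s(Out := b)"
| "effect (AuxGet i) s = s"
| "effect (AuxSet i b) s = s(Aux i := b)"

text \<open>\<^term>\<open>exec X p s s'\<close>: execution of \<^term>\<open>X\<close>, continued at position \<^term>\<open>p\<close> in state
  \<^term>\<open>s\<close>, terminates in state \<^term>\<open>s'\<close>. No rule applies to a zero jump or to a position outside
  \<^term>\<open>X\<close>, so such executions do not terminate.\<close>

inductive exec :: "instr list \<Rightarrow> nat \<Rightarrow> state \<Rightarrow> state \<Rightarrow> bool" for X :: "instr list" where
  halt: "instr_at X p Halt \<Longrightarrow> exec X p s s"
| plain: "instr_at X p (Plain a) \<Longrightarrow> exec X (p + 1) (effect a s) s' \<Longrightarrow> exec X p s s'"
| pos: "instr_at X p (Pos a) \<Longrightarrow>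
    exec X (if reply a s then p + 1 else p + 2) (effect a s) s' \<Longrightarrow> exec X p s s'"
| neg: "instr_at X p (Neg a) \<Longrightarrow>
    exec X (if reply a s then p + 2 else p + 1) (effect a s) s' \<Longrightarrow> exec X p s s'"
| jump: "instr_at X p (Jump l) \<Longrightarrow> l \<ge> 1 \<Longrightarrow> exec X (p + l) s s' \<Longrightarrow> exec X p s s'"

text \<open>An \<open>n\<close>-ary Boolean function is a function on Boolean lists, of which only the values at lists
  of length \<open>n\<close> matter.\<close>

definition computes :: "nat \<Rightarrow> instr list \<Rightarrow> (bool list \<Rightarrow> bool) \<Rightarrow> bool" where
  "computes n X f \<longleftrightarrow>
    (\<exists>k. \<forall>bs s. length bs = n \<longrightarrow>
      (\<forall>i\<in>{1..n}. s (In i) = bs ! (i - 1)) \<longrightarrow> s Out = False \<longrightarrow>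
      (\<forall>i\<in>{1..k}. s (Aux i) = False) \<longrightarrow>
      (\<exists>s'. exec X 1 s s' \<and> s' Out = f bs))"

definition tstnz :: "nat \<Rightarrow> bool list \<Rightarrow> bool" where
  "tstnz n bs \<longleftrightarrow> (\<exists>i\<in>{1..n}. bs ! (i - 1) = True)"

definition reads :: "nat \<Rightarrow> instr \<Rightarrow> bool" where
  "reads i u \<longleftrightarrow> u = Pos (InGet i) \<or> u = Neg (InGet i)"

definition times_read :: "instr list \<Rightarrow> nat \<Rightarrow> nat" where
  "times_read X i = length (filter (reads i) X)"

definition seqs :: "nat \<Rightarrow> nat \<Rightarrow> (nat \<Rightarrow> instr list) \<Rightarrow> instr list" where
  "seqs p q P = concat (map P [p..<Suc q])"

definition C_even :: "nat \<Rightarrow> instr list set" where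
  "C_even n = {X. \<exists>\<rho> \<phi>.
     bij_betw \<rho> {1..n} {1..n} \<and>
     (\<forall>j\<in>{1..n div 2}. \<phi> j \<in>
        {Jump (3 * k) | k. k \<ge> 1 \<and> k \<le> n div 2 - j} \<union>
        {Plain (OutSet True), Pos (OutSet True), Neg (OutSet True)}) \<and>
     \<phi> (n div 2) \<in> {Plain (OutSet True), Pos (OutSet True)} \<and>
     X = seqs 1 (n div 2)
           (\<lambda>i. [Neg (InGet (\<rho> (2 * i - 1))), Pos (InGet (\<rho> (2 * i))), \<phi> i])
         @ [Halt]}"

definition C_odd :: "nat \<Rightarrow> instr list set" where
  "C_odd n = {X. \<exists>m \<rho> \<phi>.
     m \<le> (n - 1) div 2 \<and>
     bij_betw \<rho> {1..n} {1..n} \<and>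
     (\<forall>j\<in>{1..(n + 1) div 2}. \<phi> j \<in>
        {Jump (3 * k - 1) | k. k \<ge> 1 \<and> k \<le> (n + 1) div 2 - j \<and> (j \<le> m \<and> m < j + k)} \<union>
        {Jump (3 * k) | k. k \<ge> 1 \<and> k \<le> (n + 1) div 2 - j \<and> \<not> (j \<le> m \<and> m < j + k)} \<union>
        {Plain (OutSet True), Pos (OutSet True), Neg (OutSet True)}) \<and>
     \<phi> ((n + 1) div 2) \<in> {Plain (OutSet True), Pos (OutSet True)} \<and>
     X = seqs 1 m
           (\<lambda>i. [Neg (InGet (\<rho> (2 * i - 1))), Pos (InGet (\<rho> (2 * i))), \<phi> i])
         @ [Pos (InGet (\<rho> (2 * m + 1))), \<phi> (m + 1)]
         @ seqs (m + 1) ((n - 1) div 2)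
             (\<lambda>i. [Neg (InGet (\<rho> (2 * i))), Pos (InGet (\<rho> (2 * i + 1))), \<phi> (i + 1)])
         @ [Halt]}"

definition C_class :: "nat \<Rightarrow> instr list set" where
  "C_class n = (if even n then C_even n else C_odd n)"

definition jump_step :: "instr list \<Rightarrow> nat \<Rightarrow> nat \<Rightarrow> bool" where
  "jump_step X p q \<longleftrightarrow> (\<exists>l\<ge>1. instr_at X p (Jump l) \<and> q = p + l)"

definition jump_chain :: "instr list \<Rightarrow> nat \<Rightarrow> nat \<Rightarrow> bool" where
  "jump_chain X = (jump_step X)\<^sup>*\<^sup>*"

text \<open>The two positions reading the doubly read register are quantified existentially: by the
  zero-length chain, the first condition forces \<open>l > k + 2\<close>, so a universal reading over
  ordered pairs could never be satisfied.\<close>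

definition E_class :: "nat \<Rightarrow> instr list set" where
  "E_class n = {X \<in> IS.
     ((\<forall>i. times_read X i \<le> 1) \<and> X \<in> C_class n) \<or>
     (\<exists>i. times_read X i = 2 \<and> (\<forall>j. j \<noteq> i \<longrightarrow> times_read X j \<le> 1) \<and>
       (\<exists>k l u v. k \<noteq> l \<and> instr_at X k u \<and> reads i u \<and> instr_at X l v \<and> reads i v \<and>
         \<not> (\<exists>p\<le>k + 2. jump_chain X p l) \<and>
         (\<exists>i'\<le>n. v = Pos (InGet i')) \<and>
         X[l - 1 := Jump 2] \<in> C_class n))}"

end

theory Submission
  imports Defs
begin

text \<open>Every program in the classes consists of blocks that test one or two inputs and, if one of
  them is 1, reach the action ending the block; otherwise they fall through to the next block. An
  action either sets the output or jumps to a later action, and nothing ever resets the output. In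
  the doubly reading case the jump \<open>#2\<close> at some action \<open>l\<close> is replaced by \<open>+in:i.get\<close>, which acts
  like \<open>#2\<close> when \<open>in:i\<close> is 0. If \<open>in:i\<close> is 1, then the output has already been set when \<open>l\<close> is
  reached: at the latest the earlier read of \<open>in:i\<close> leads to an action, and by the condition on jump
  chains that action cannot lead to \<open>l\<close> without setting the output first.\<close>

section \<open>Positions in a program and the block structure\<close>

lemma instr_at_unique: "instr_at X p u \<Longrightarrow> instr_at X p v \<Longrightarrow> u = v"
  by (simp add: instr_at_def)

lemma ex_reads_iff: "(\<exists>u\<in>set X. reads a u) \<longleftrightarrow> (\<exists>p u. instr_at X p u \<and> reads a u)"
proof
  assume "\<exists>u\<in>set X. reads a u"
  then obtain q where "q < length X" "reads a (X ! q)" by (auto simp: in_set_conv_nth)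
  then have "instr_at X (q + 1) (X ! q)" by (simp add: instr_at_def)
  then show "\<exists>p u. instr_at X p u \<and> reads a u" using \<open>reads a (X ! q)\<close> by blast
qed (auto simp: instr_at_def)

text \<open>Position \<open>f j\<close> holds the action that ends block \<open>j\<close>.\<close>

definition block_layout :: "instr list \<Rightarrow> (nat \<Rightarrow> nat) \<Rightarrow> nat \<Rightarrow> bool" where
  "block_layout X f M \<longleftrightarrow> f 0 = 0 \<and> length X = f M + 1 \<and> instr_at X (f M + 1) Halt \<and>
    (\<forall>j<M.
      (f (Suc j) = f j + 3 \<and> (\<exists>a. instr_at X (f j + 1) (Neg (InGet a))) \<and>
        (\<exists>b. instr_at X (f j + 2) (Pos (InGet b)))) \<or>
      (f (Suc j) = f j + 2 \<and> (\<exists>a. instr_at X (f j + 1) (Pos (InGet a)))))"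

text \<open>Jump lengths are written as differences of action positions, which covers the lengths
  \<open>3k\<close> and \<open>3k - 1\<close> of both parities at once. The negative test of setting
  the output skips an instruction, so it is confined to \<open>j < M\<close>: after the last action
  it would skip the final \<open>Halt\<close>.\<close>

definition block_action :: "instr list \<Rightarrow> (nat \<Rightarrow> nat) \<Rightarrow> nat \<Rightarrow> nat \<Rightarrow> bool" where
  "block_action X f M j \<longleftrightarrow>
    (\<exists>j'. j < j' \<and> j' \<le> M \<and> instr_at X (f j) (Jump (f j' - f j))) \<or>
    instr_at X (f j) (Plain (OutSet True)) \<or> instr_at X (f j) (Pos (OutSet True)) \<or>
    (j < M \<and> instr_at X (f j) (Neg (OutSet True)))"

lemma block_layout_step:
  assumes "block_layout X f M" "j < M"
  shows "f j + 2 \<le> f (Suc j)"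
  using assms unfolding block_layout_def by fastforce

text \<open>Each block contributes at least 2. The factor 2 matters later: it shows that a jump of
  length 2 between actions can only lead to the next action.\<close>

lemma block_layout_less:
  assumes L: "block_layout X f M" and "j < j'" "j' \<le> M"
  shows "f j + 2 * (j' - j) \<le> f j'"
  using assms(2,3)
proof (induction j')
  case (Suc j')
  show ?case
  proof (cases "j = j'")
    case True
    then show ?thesis using block_layout_step[OF L, of j] Suc.prems by simp
  next
    case False
    then show ?thesis using block_layout_step[OF L, of j'] Suc by fastforce
  qed
qed simp

lemma block_layout_mono:
  assumes "block_layout X f M" "j \<le> j'" "j' \<le> M"
  shows "f j \<le> f j'"
  using block_layout_less[OF assms(1), of j j'] assms by (cases "j = j'") auto

lemma block_layout_cover:
  assumes "f 0 = (0::nat)" "1 \<le> p" "p \<le> f M"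
  shows "\<exists>j<M. f j < p \<and> p \<le> f (Suc j)"
  using assms(3)
proof (induction M)
  case 0
  then show ?case using assms by simp
next
  case (Suc M)
  then show ?case by (cases "p \<le> f M") (auto intro: less_SucI)
qed

section \<open>Execution of block programs with at most one repeated read\<close>

text \<open>\<open>T\<close> collects the positions from which a jump chain leads to the second read of \<open>in:i\<close>, and \<open>k\<close>
  is the position of the first one. If no input is read twice, \<open>T\<close> is empty and \<open>k\<close> is the final
  position.\<close>

locale reading_program =
  fixes X :: "instr list" and f :: "nat \<Rightarrow> nat" and M :: nat
    and T :: "nat set" and i k :: nat
  assumes layout: "block_layout X f M"
    and action: "\<And>j. 1 \<le> j \<Longrightarrow> j \<le> M \<Longrightarrow> block_action X f M j \<or>
      (f j \<in> T \<and> instr_at X (f j) (Pos (InGet i)) \<and> j < M \<and> f (Suc j) = f j + 2)"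
    and chain: "\<And>p l. instr_at X p (Jump l) \<Longrightarrow> 1 \<le> l \<Longrightarrow> p + l \<in> T \<Longrightarrow> p \<in> T"
    and late: "\<And>p. p \<in> T \<Longrightarrow> k + 2 < p"
    and first_read: "k \<le> f M \<Longrightarrow> instr_at X k (Pos (InGet i)) \<or> instr_at X k (Neg (InGet i))"
begin

lemma length_X: "length X = f M + 1" and f_0: "f 0 = 0" and halt_at: "instr_at X (f M + 1) Halt"
  using layout by (auto simp: block_layout_def)

lemma f_less: "j < j' \<Longrightarrow> j' \<le> M \<Longrightarrow> f j < f j'"
  using block_layout_less[OF layout, of j j'] by simp

lemma f_le: "j \<le> j' \<Longrightarrow> j' \<le> M \<Longrightarrow> f j \<le> f j'"
  using block_layout_mono[OF layout] .

lemma block_cases: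
  assumes "j < M"
  obtains (two) a b where "f (Suc j) = f j + 3" "instr_at X (f j + 1) (Neg (InGet a))"
      "instr_at X (f j + 2) (Pos (InGet b))"
    | (one) a where "f (Suc j) = f j + 2" "instr_at X (f j + 1) (Pos (InGet a))"
  using layout assms unfolding block_layout_def by blast

lemma f_Suc_le: "j < M \<Longrightarrow> f (Suc j) \<le> f j + 3"
  by (cases rule: block_cases) auto

lemma action_cases:
  assumes "1 \<le> j" "j \<le> M"
  obtains (jump) j' where "j < j'" "j' \<le> M" "instr_at X (f j) (Jump (f j' - f j))"
    | (plain) "instr_at X (f j) (Plain (OutSet True))"
    | (pos) "instr_at X (f j) (Pos (OutSet True))"
    | (neg) "j < M" "instr_at X (f j) (Neg (OutSet True))"
    | (read) "f j \<in> T" "instr_at X (f j) (Pos (InGet i))" "j < M" "f (Suc j) = f j + 2"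
  using action[OF assms] unfolding block_action_def by blast

text \<open>Every instruction moves strictly forward and never past the final \<open>Halt\<close>,
  so execution terminates by induction on the distance to the end. No instruction in the layout sets
  the output to 0.\<close>

lemma exec_out_set:
  assumes "1 \<le> p" "p \<le> f M + 1" "s Out"
  shows "\<exists>s'. exec X p s s' \<and> s' Out"
  using assms
proof (induction "f M + 1 - p" arbitrary: p s rule: less_induct)
  case less
  have IH: "\<exists>s'. exec X q t s' \<and> s' Out" if "p < q" "q \<le> f M + 1" "t Out" for q t
    using less.hyps[of q t] that less.prems by simp
  show ?case
  proof (cases "p = f M + 1")
    case True
    then show ?thesis using halt_at less.prems exec.halt by blast
  next
    case False
    then have "p \<le> f M" using less.prems by simp
    then obtain j where j: "j < M" "f j < p" "p \<le> f (Suc j)"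
      using block_layout_cover[of f p M] f_0 less.prems by blast
    have fS: "f (Suc j) \<le> f M" using f_le j by simp
    show ?thesis
    proof (cases "p = f (Suc j)")
      case True
      have "1 \<le> Suc j" "Suc j \<le> M" using j by auto
      then show ?thesis
      proof (cases rule: action_cases)
        case (jump j')
        have "f (Suc j) < f j'" "f j' \<le> f M" using f_less f_le jump by auto
        then show ?thesis using IH[of "f j'" s] jump(3) less.prems True
          exec.jump[of X p "f j' - p" s] by fastforce
      next
        case plain
        then show ?thesis using IH[of "p + 1" "s(Out := True)"] fS True
          exec.plain[of X p "OutSet True" s] by fastforce
      next
        case pos
        then show ?thesis using IH[of "p + 1" "s(Out := True)"] fS True
          exec.pos[of X p "OutSet True" s] by fastforce
      next
        case neg
        have "f (Suc j) < f M" using neg f_less by simp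
        then show ?thesis using IH[of "p + 2" "s(Out := True)"] neg True
          exec.neg[of X p "OutSet True" s] by fastforce
      next
        case read
        have "f (Suc j) + 2 \<le> f M" using read f_le[of "Suc (Suc j)" M] by simp
        then show ?thesis using IH[of "p + 1" s] IH[of "p + 2" s] read True less.prems
          exec.pos[of X p "InGet i" s] by (cases "s (In i)") fastforce+
      qed
    next
      case False
      have p: "p + 1 \<le> f (Suc j)" using False j by simp
      have "(\<exists>a. instr_at X p (Neg (InGet a))) \<or> (\<exists>a. instr_at X p (Pos (InGet a)))"
        using j(1)
      proof (cases rule: block_cases)
        case (two a b)
        then have "p = f j + 1 \<or> p = f j + 2" using j p by auto
        then show ?thesis using two by auto
      next
        case (one a)
        then have "p = f j + 1" using j p by auto
        then show ?thesis using one by auto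
      qed
      then show ?thesis
      proof (elim disjE exE)
        fix a assume "instr_at X p (Neg (InGet a))"
        then show ?thesis using IH[of "p + 1" s] IH[of "p + 2" s] p fS less.prems
          exec.neg[of X p "InGet a" s] by (cases "s (In a)") fastforce+
      next
        fix a assume "instr_at X p (Pos (InGet a))"
        then show ?thesis using IH[of "p + 1" s] IH[of "p + 2" s] p fS less.prems
          exec.pos[of X p "InGet a" s] by (cases "s (In a)") fastforce+
      qed
    qed
  qed
qed

text \<open>Each action either sets the output or passes control to a later action: a jump by its
  length, the second read of \<open>In i\<close> by skipping one instruction when the reply is 0.
  The assumption on \<open>T\<close> survives a jump because \<open>T\<close> is closed backwards
  under jumps.\<close>

lemma exec_action:
  assumes "1 \<le> j" "j \<le> M" "f j \<in> T \<Longrightarrow> \<not> s (In i)"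
  shows "\<exists>s'. exec X (f j) s s' \<and> s' Out"
  using assms
proof (induction "M - j" arbitrary: j rule: less_induct)
  case less
  have le: "f j \<le> f M" using f_le less.prems by simp
  have out: "\<exists>s'. exec X q (s(Out := True)) s' \<and> s' Out" if "1 \<le> q" "q \<le> f M + 1" for q
    using exec_out_set[of q "s(Out := True)"] that by simp
  show ?case
    using less.prems(1,2)
  proof (cases rule: action_cases)
    case (jump j')
    have lt: "f j < f j'" using f_less jump by auto
    then have "f j' \<in> T \<Longrightarrow> \<not> s (In i)"
      using chain[OF jump(3)] less.prems(3) by simp
    then obtain s' where "exec X (f j') s s'" "s' Out"
      using less.hyps[of j'] jump(1,2) less.prems(1) by (meson diff_less_mono2 le_trans less_imp_le order_less_le_trans)
    then show ?thesis using exec.jump[OF jump(3), of s s'] lt by (auto simp: Suc_le_eq)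
  next
    case plain
    then show ?thesis using out[of "f j + 1"] le exec.plain[OF plain, of s] by fastforce
  next
    case pos
    then show ?thesis using out[of "f j + 1"] le exec.pos[OF pos, of s] by fastforce
  next
    case neg
    have "f j < f M" using neg f_less by simp
    then show ?thesis using out[of "f j + 2"] exec.neg[OF neg(2), of s] by fastforce
  next
    case read
    have i: "\<not> s (In i)" using less.prems(3) read by blast
    then obtain s' where "exec X (f (Suc j)) s s'" "s' Out"
      using less.hyps[of "Suc j"] read(3) less.prems(1) by (metis Suc_leI diff_less_mono2 le_SucI lessI)
    then show ?thesis using exec.pos[OF read(2), of s s'] i read by auto
  qed
qed

text \<open>The only action that can read is the second read of \<open>In i\<close>; it lies in
  \<open>T\<close>, hence beyond \<open>k + 2\<close>.\<close>

lemma first_read_not_action: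
  assumes "1 \<le> j" "j \<le> M"
  shows "k \<noteq> f j"
proof
  assume k: "k = f j"
  then have fr: "instr_at X (f j) (Pos (InGet i)) \<or> instr_at X (f j) (Neg (InGet i))"
    using first_read f_le assms by simp
  show False
    using assms
  proof (cases rule: action_cases)
    case read
    then show ?thesis using late k by fastforce
  qed (use fr in \<open>auto dest: instr_at_unique\<close>)
qed

lemma action_reads:
  assumes "1 \<le> j" "j \<le> M" "instr_at X (f j) u" "reads a u"
  shows "a = i \<and> f j \<in> T"
  using assms(1,2)
  by (cases rule: action_cases) (use assms(3,4) in \<open>auto simp: reads_def dest: instr_at_unique\<close>)

text \<open>Taken from the program text, not from an execution: positions that a run jumps over
  count as well.\<close>

definition reads_from :: "nat \<Rightarrow> nat set" where
  "reads_from p = {a. \<exists>q\<ge>p. \<exists>u. instr_at X q u \<and> reads a u}"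

lemma reads_from_antimono: "p \<le> q \<Longrightarrow> reads_from q \<subseteq> reads_from p"
  unfolding reads_from_def using order_trans by blast

text \<open>Backward induction over block entries. The assumption on \<open>k\<close> is the
  invariant of falling through: once the first read of \<open>In i\<close> has been passed without
  reaching an action, \<open>In i\<close> must be 0, so the second read behaves like a jump of
  length 2.\<close>

lemma exec_block:
  assumes "j \<le> M" "\<not> s Out" "k \<le> f j \<Longrightarrow> \<not> s (In i)"
  shows "\<exists>s'. exec X (f j + 1) s s' \<and> (s' Out \<longleftrightarrow> (\<exists>a\<in>reads_from (f j + 1). s (In a)))"
  using assms
proof (induction "M - j" arbitrary: j rule: less_induct)
  case less
  show ?case
  proof (cases "j = M")
    case True
    have "q = f M + 1" if "instr_at X q u" "q \<ge> f M + 1" for q u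
      using that length_X by (simp add: instr_at_def)
    then have "reads_from (f M + 1) = {}"
      using halt_at by (auto simp: reads_from_def reads_def dest: instr_at_unique)
    then show ?thesis using True halt_at exec.halt[of X "f M + 1" s] less.prems by auto
  next
    case False
    then have j: "j < M" using less.prems by simp
    have act: "\<exists>s'. exec X (f (Suc j)) s s' \<and> s' Out"
    proof (rule exec_action)
      assume T: "f (Suc j) \<in> T"
      \<comment> \<open>The bound \<open>k + 2\<close> is exactly what is needed:
        \<open>k + 2 < f (Suc j) \<le> f j + 3\<close> gives \<open>k \<le> f j\<close>, so the
        first read lies in an earlier block.\<close>
      show "\<not> s (In i)" using f_Suc_le[OF j] less.prems(3) late[OF T] by simp
    qed (use j in auto)
    have next_block: "\<exists>s'. exec X (f (Suc j) + 1) s s' \<and>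
        (s' Out \<longleftrightarrow> (\<exists>a\<in>reads_from (f (Suc j) + 1). s (In a)))"
      if "k \<le> f (Suc j) \<Longrightarrow> \<not> s (In i)"
      using less.hyps[of "Suc j"] j less.prems that by simp
    \<comment> \<open>A read in the action that ends the block is the second read of
      \<open>In i\<close>, and that register is 0 here.\<close>
    have last: "a = i \<and> \<not> s (In i)" if "instr_at X (f (Suc j)) u" "reads a u" for a u
    proof -
      have *: "a = i" "f (Suc j) \<in> T" using action_reads[of "Suc j"] that j by auto
      show ?thesis using f_Suc_le[OF j] less.prems(3) late[OF *(2)] * by simp
    qed
    have k_le: "k \<le> f j \<or> (f j < k \<and> k < f (Suc j))" if "k \<le> f (Suc j)"
      using that first_read_not_action[of "Suc j"] j by auto
    have fS: "f (Suc j) \<le> f M" using f_le j by simp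
    show ?thesis
      using j
    proof (cases rule: block_cases)
      case (two a b)
      have mem: "a \<in> reads_from (f j + 1)" "b \<in> reads_from (f j + 1)"
        using two by (auto simp: reads_from_def reads_def intro: le_SucI)
      show ?thesis
      \<comment> \<open>Reply 1 to the negative test skips the second test, and reply 0 to the
        positive test skips the action. Hence the action is reached exactly when one of the two
        inputs is 1.\<close>
      proof (cases "s (In a) \<or> s (In b)")
        case True
        obtain s' where s': "exec X (f j + 3) s s'" "s' Out" using act two by auto
        have "exec X (f j + 1) s s'"
        proof (cases "s (In a)")
          case True
          then show ?thesis using exec.neg[OF two(2), of s s'] s' by (simp add: numeral_3_eq_3)
        next
          case False
          then have "exec X (f j + 2) s s'"
            using exec.pos[OF two(3), of s s'] s' True by (simp add: numeral_3_eq_3)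
          then show ?thesis using exec.neg[OF two(2), of s s'] False by simp
        qed
        then show ?thesis using s' True mem by blast
      next
        case F: False
        \<comment> \<open>The invariant for the next block: if \<open>k\<close> lies inside this
          block, then \<open>In i\<close> is one of the two registers just found to be 0.\<close>
        have ni: "\<not> s (In i)" if "k \<le> f (Suc j)"
        proof (cases "k \<le> f j")
          case False
          then have "k = f j + 1 \<or> k = f j + 2" using k_le[OF that] two by auto
          then have "i = a \<or> i = b"
            using first_read two that fS by (auto dest: instr_at_unique)
          then show ?thesis using F by auto
        qed (use less.prems in blast)
        obtain s' where s': "exec X (f (Suc j) + 1) s s'"
            "s' Out \<longleftrightarrow> (\<exists>a\<in>reads_from (f (Suc j) + 1). s (In a))"
          using next_block ni by blast
        have "exec X (f j + 2) s s'"
          using exec.pos[OF two(3), of s s'] s' F two by (simp add: numeral_eq_Suc)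
        then have e: "exec X (f j + 1) s s'" using exec.neg[OF two(2), of s s'] F by simp
        \<comment> \<open>All registers read in this block, its action included, are 0, so skipping
          it loses no register with content 1.\<close>
        have "c \<in> reads_from (f (Suc j) + 1)" if c: "c \<in> reads_from (f j + 1)" "s (In c)" for c
        proof -
          obtain q u where q: "q \<ge> f j + 1" "instr_at X q u" "reads c u"
            using c by (auto simp: reads_from_def)
          have "q \<noteq> f j + 1" "q \<noteq> f j + 2" "q \<noteq> f (Suc j)"
            using q two F c last[of u c] by (auto simp: reads_def dest: instr_at_unique)
          then have "q \<ge> f (Suc j) + 1" using q two by simp
          then show ?thesis using q by (auto simp: reads_from_def)
        qed
        moreover have "reads_from (f (Suc j) + 1) \<subseteq> reads_from (f j + 1)"
          using reads_from_antimono two(1) by simp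
        ultimately show ?thesis using e s' by blast
      qed
    next
      case (one a)
      have mem: "a \<in> reads_from (f j + 1)"
        using one by (auto simp: reads_from_def reads_def)
      show ?thesis
      proof (cases "s (In a)")
        case True
        obtain s' where s': "exec X (f j + 2) s s'" "s' Out" using act one by auto
        have "exec X (f j + 1) s s'"
          using exec.pos[OF one(2), of s s'] s' True by simp
        then show ?thesis using s' True mem by blast
      next
        case F: False
        have ni: "\<not> s (In i)" if "k \<le> f (Suc j)"
        proof (cases "k \<le> f j")
          case False
          then have "k = f j + 1" using k_le[OF that] one by auto
          then have "i = a"
            using first_read one that fS by (auto dest: instr_at_unique)
          then show ?thesis using F by auto
        qed (use less.prems in blast)
        obtain s' where s': "exec X (f (Suc j) + 1) s s'"
            "s' Out \<longleftrightarrow> (\<exists>a\<in>reads_from (f (Suc j) + 1). s (In a))"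
          using next_block ni by blast
        have e: "exec X (f j + 1) s s'"
          using exec.pos[OF one(2), of s s'] s' F one by (simp add: numeral_eq_Suc)
        have "c \<in> reads_from (f (Suc j) + 1)" if c: "c \<in> reads_from (f j + 1)" "s (In c)" for c
        proof -
          obtain q u where q: "q \<ge> f j + 1" "instr_at X q u" "reads c u"
            using c by (auto simp: reads_from_def)
          have "q \<noteq> f j + 1" "q \<noteq> f (Suc j)"
            using q one F c last[of u c] by (auto simp: reads_def dest: instr_at_unique)
          then have "q \<ge> f (Suc j) + 1" using q one by simp
          then show ?thesis using q by (auto simp: reads_from_def)
        qed
        moreover have "reads_from (f (Suc j) + 1) \<subseteq> reads_from (f j + 1)"
          using reads_from_antimono one(1) by simp
        ultimately show ?thesis using e s' by blast
      qed
    qed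
  qed
qed

lemma computes_tstnz:
  assumes R: "{a. \<exists>u\<in>set X. reads a u} = {1..n}" and k: "1 \<le> k"
  shows "computes n X (tstnz n)"
proof -
  have "reads_from 1 = {a. \<exists>u\<in>set X. reads a u}"
    unfolding ex_reads_iff reads_from_def by (auto simp: instr_at_def)
  then have R1: "reads_from 1 = {1..n}" using R by simp
  have "\<exists>s'. exec X 1 s s' \<and> s' Out = tstnz n bs"
    if "\<forall>i\<in>{1..n}. s (In i) = bs ! (i - 1)" "s Out = False" for s bs
  proof -
    have "\<exists>s'. exec X 1 s s' \<and> (s' Out \<longleftrightarrow> (\<exists>a\<in>{1..n}. s (In a)))"
      \<comment> \<open>At the start \<open>f 0 = 0 < k\<close>, so the invariant on
        \<open>k\<close> holds vacuously.\<close>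
      using exec_block[of 0 s] that k f_0 R1 by simp
    moreover have "(\<exists>a\<in>{1..n}. s (In a)) \<longleftrightarrow> tstnz n bs"
      using that by (auto simp: tstnz_def)
    ultimately show ?thesis by simp
  qed
  then show ?thesis unfolding computes_def by blast
qed

end

section \<open>Indexing into concatenations of triples\<close>

lemma length_concat_triples:
  fixes P :: "nat \<Rightarrow> 'a list"
  assumes "\<And>i. length (P i) = 3"
  shows "length (concat (map P [p..<p + d])) = 3 * d"
  using assms by (induction d) auto

lemma nth_concat_triples:
  fixes P :: "nat \<Rightarrow> 'a list"
  assumes "\<And>i. length (P i) = 3" "e < d" "t < 3"
  shows "concat (map P [p..<p + d]) ! (3 * e + t) = P (p + e) ! t"
  using assms(2)
proof (induction d)
  case (Suc d)
  then show ?case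
    using length_concat_triples[of P p d, OF assms(1)] assms(3)
    by (cases "e = d") (auto simp: nth_append)
qed simp

lemma length_seqs_triples:
  fixes P :: "nat \<Rightarrow> instr list"
  assumes "\<And>i. length (P i) = 3"
  shows "length (seqs p q P) = 3 * (Suc q - p)"
proof (cases "p \<le> Suc q")
  case True
  then show ?thesis
    using length_concat_triples[of P p "Suc q - p", OF assms] by (simp add: seqs_def)
qed (simp add: seqs_def)

lemma nth_seqs_triples:
  fixes P :: "nat \<Rightarrow> instr list"
  assumes "\<And>i. length (P i) = 3" "p + e \<le> q" "t < 3"
  shows "seqs p q P ! (3 * e + t) = P (p + e) ! t"
  using nth_concat_triples[of P e "Suc q - p" t p, OF assms(1)] assms by (simp add: seqs_def)

lemma set_seqs: "set (seqs p q P) = (\<Union>i\<in>{p..q}. set (P i))"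
  by (simp add: seqs_def atLeastLessThanSuc_atLeastAtMost del: upt_Suc)

section \<open>Block layouts of the programs in \<open>C_class\<close>\<close>

text \<open>All blocks have length 3, so action \<open>j\<close> stands at position
  \<open>3 * j\<close>, and a jump of length \<open>3 * k\<close> leads exactly \<open>k\<close>
  actions further.\<close>

lemma C_even_layout:
  assumes n: "n \<ge> 1" "even n" and X: "X \<in> C_even n"
  shows "\<exists>f M. block_layout X f M \<and> (\<forall>j\<in>{1..M}. block_action X f M j) \<and>
    {a. \<exists>u\<in>set X. reads a u} = {1..n}"
proof -
  define M where "M = n div 2"
  have M: "1 \<le> M" "n = 2 * M" using n by (auto simp: M_def)
  obtain \<rho> \<phi> where \<rho>: "bij_betw \<rho> {1..n} {1..n}"
    and \<phi>: "\<And>j. j \<in> {1..M} \<Longrightarrow> \<phi> j \<in> {Jump (3 * k) | k. k \<ge> 1 \<and> k \<le> M - j} \<union>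
        {Plain (OutSet True), Pos (OutSet True), Neg (OutSet True)}"
    and \<phi>M: "\<phi> M \<in> {Plain (OutSet True), Pos (OutSet True)}"
    and X_eq: "X = seqs 1 M
           (\<lambda>i. [Neg (InGet (\<rho> (2 * i - 1))), Pos (InGet (\<rho> (2 * i))), \<phi> i]) @ [Halt]"
    using X unfolding C_even_def M_def by blast
  define P where "P i = [Neg (InGet (\<rho> (2 * i - 1))), Pos (InGet (\<rho> (2 * i))), \<phi> i]" for i
  have P3: "length (P i) = 3" for i by (simp add: P_def)
  have X': "X = seqs 1 M P @ [Halt]" using X_eq unfolding P_def .
  have len: "length (seqs (Suc 0) M P) = 3 * M" using length_seqs_triples[of P 1 M, OF P3] by simp
  have at: "instr_at X (3 * j + t + 1) (P (Suc j) ! t)" if "j < M" "t < 3" for j t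
    using nth_seqs_triples[of P 1 j M t, OF P3] that len
    by (auto simp: instr_at_def X' nth_append)
  have L: "block_layout X ((*) 3) M"
    unfolding block_layout_def
  proof (intro conjI allI impI disjI1)
    show "instr_at X (3 * M + 1) Halt" by (simp add: instr_at_def X' len nth_append)
    fix j assume j: "j < M"
    show "\<exists>a. instr_at X (3 * j + 1) (Neg (InGet a))" using at[OF j, of 0] by (auto simp: P_def)
    show "\<exists>a. instr_at X (3 * j + 2) (Pos (InGet a))" using at[OF j, of 1] by (auto simp: P_def)
  qed (auto simp: X' len)
  have A: "block_action X ((*) 3) M j" if j: "j \<in> {1..M}" for j
  proof -
    have atj: "instr_at X (3 * j) (\<phi> j)"
      using at[of "j - 1" 2] j by (cases j) (auto simp: P_def eval_nat_numeral)
    consider (jump) k where "\<phi> j = Jump (3 * k)" "k \<ge> 1" "k \<le> M - j"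
      | (plain) "\<phi> j = Plain (OutSet True)" | (pos) "\<phi> j = Pos (OutSet True)"
      | (neg) "\<phi> j = Neg (OutSet True)" using \<phi>[OF j] by blast
    then show ?thesis
    proof cases
      case jump
      then show ?thesis using atj j unfolding block_action_def
        by (intro disjI1 exI[of _ "j + k"]) auto
    next
      case neg
      then have "j < M" using \<phi>M j by (cases "j = M") auto
      then show ?thesis using atj neg by (simp add: block_action_def)
    qed (use atj in \<open>simp_all add: block_action_def\<close>)
  qed
  have \<phi>_no_read: "\<not> reads a (\<phi> j)" if "j \<in> {1..M}" for a j
    using \<phi>[OF that] by (auto simp: reads_def)
  have "{a. \<exists>u\<in>set X. reads a u} = \<rho> ` {1..n}"
  proof (intro set_eqI iffI)
    fix a assume "a \<in> {a. \<exists>u\<in>set X. reads a u}"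
    then obtain j where j: "j \<in> {1..M}" "a = \<rho> (2 * j - 1) \<or> a = \<rho> (2 * j)"
      using \<phi>_no_read by (auto simp: X' set_seqs P_def reads_def)
    then have "2 * j - 1 \<in> {1..n}" "2 * j \<in> {1..n}" using M by auto
    then show "a \<in> \<rho> ` {1..n}" using j by blast
  next
    fix a assume "a \<in> \<rho> ` {1..n}"
    then obtain c where c: "a = \<rho> c" "c \<in> {1..n}" by blast
    \<comment> \<open>The block whose tests are numbered \<open>2 * j - 1\<close> and
      \<open>2 * j\<close>, one of which is \<open>c\<close>.\<close>
    define j where "j = (c + 1) div 2"
    have j: "j \<in> {1..M}" "c = 2 * j - 1 \<or> c = 2 * j" using c M unfolding j_def by auto
    then have "Neg (InGet a) \<in> set (P j) \<or> Pos (InGet a) \<in> set (P j)" using c by (auto simp: P_def)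
    then show "a \<in> {a. \<exists>u\<in>set X. reads a u}" using j by (auto simp: X' set_seqs reads_def)
  qed
  then have "{a. \<exists>u\<in>set X. reads a u} = {1..n}" using \<rho> by (simp add: bij_betw_def)
  then show ?thesis using L A by blast
qed

text \<open>Block \<open>m + 1\<close> has a single test and length 2, all others have length 3. A
  jump is therefore one shorter than a multiple of 3 exactly when it passes over that block.\<close>

lemma C_odd_layout:
  assumes n: "odd n" and X: "X \<in> C_odd n"
  shows "\<exists>f M. block_layout X f M \<and> (\<forall>j\<in>{1..M}. block_action X f M j) \<and>
    {a. \<exists>u\<in>set X. reads a u} = {1..n}"
proof -
  define M where "M = (n + 1) div 2"
  have M: "1 \<le> M" "n = 2 * M - 1" "(n - 1) div 2 = M - 1" using n by (auto simp: M_def elim!: oddE)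
  obtain m \<rho> \<phi> where m: "m \<le> M - 1" and \<rho>: "bij_betw \<rho> {1..n} {1..n}"
    and \<phi>: "\<And>j. j \<in> {1..M} \<Longrightarrow> \<phi> j \<in>
        {Jump (3 * k - 1) | k. k \<ge> 1 \<and> k \<le> M - j \<and> (j \<le> m \<and> m < j + k)} \<union>
        {Jump (3 * k) | k. k \<ge> 1 \<and> k \<le> M - j \<and> \<not> (j \<le> m \<and> m < j + k)} \<union>
        {Plain (OutSet True), Pos (OutSet True), Neg (OutSet True)}"
    and \<phi>M: "\<phi> M \<in> {Plain (OutSet True), Pos (OutSet True)}"
    and X_eq: "X = seqs 1 m
           (\<lambda>i. [Neg (InGet (\<rho> (2 * i - 1))), Pos (InGet (\<rho> (2 * i))), \<phi> i])
         @ [Pos (InGet (\<rho> (2 * m + 1))), \<phi> (m + 1)]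
         @ seqs (m + 1) (M - 1)
             (\<lambda>i. [Neg (InGet (\<rho> (2 * i))), Pos (InGet (\<rho> (2 * i + 1))), \<phi> (i + 1)])
         @ [Halt]"
    using X unfolding C_odd_def M(3) M_def[symmetric] mem_Collect_eq
    by (elim exE conjE) (rule that, (assumption | erule (1) bspec)+)
  define P where "P i = [Neg (InGet (\<rho> (2 * i - 1))), Pos (InGet (\<rho> (2 * i))), \<phi> i]" for i
  define Q where "Q i = [Neg (InGet (\<rho> (2 * i))), Pos (InGet (\<rho> (2 * i + 1))), \<phi> (i + 1)]" for i
  define R where "R = [Pos (InGet (\<rho> (2 * m + 1))), \<phi> (m + 1)]"
  have P3: "length (P i) = 3" and Q3: "length (Q i) = 3" for i by (simp_all add: P_def Q_def)
  have R2: "length R = 2" by (simp add: R_def)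
  have X': "X = seqs 1 m P @ R @ seqs (m + 1) (M - 1) Q @ [Halt]"
    using X_eq unfolding P_def Q_def R_def .
  have lenP: "length (seqs (Suc 0) m P) = 3 * m" using length_seqs_triples[of P 1 m, OF P3] by simp
  have lenQ: "length (seqs (Suc m) (M - Suc 0) Q) = 3 * (M - (m + 1))"
    using length_seqs_triples[of Q "m + 1" "M - 1", OF Q3] M by simp
  have lenX: "length X = 3 * M" using m M by (simp add: X' lenP lenQ R2)
  have atP: "instr_at X (3 * j + t + 1) (P (Suc j) ! t)" if "j < m" "t < 3" for j t
    using nth_seqs_triples[of P 1 j m t, OF P3] that lenP
    by (auto simp: instr_at_def X' nth_append)
  have atR: "instr_at X (3 * m + t + 1) (R ! t)" if "t < 2" for t
    using that lenP R2 by (auto simp: instr_at_def X' nth_append)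
  \<comment> \<open>The triple \<open>Q j\<close> is preceded by
    \<open>3 * m + 2 + 3 * (j - (m + 1)) = 3 * j - 1\<close> instructions and so starts at position
    \<open>3 * j\<close>; it forms block \<open>j + 1\<close>.\<close>
  have atQ: "instr_at X (3 * j + t) (Q j ! t)" if "m < j" "j < M" "t < 3" for j t
  proof -
    have "seqs (m + 1) (M - 1) Q ! (3 * (j - (m + 1)) + t) = Q j ! t"
      using nth_seqs_triples[of Q "m + 1" "j - (m + 1)" "M - 1" t, OF Q3] that by simp
    moreover have "3 * (j - (m + 1)) + t < 3 * (M - (m + 1))" using that by linarith
    then have "X ! (3 * m + (2 + (3 * (j - (m + 1)) + t))) =
        seqs (m + 1) (M - 1) Q ! (3 * (j - (m + 1)) + t)"
      by (simp add: X' nth_append lenP lenQ R2)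
    moreover have "3 * m + (2 + (3 * (j - (m + 1)) + t)) = 3 * j + t - 1" using that by simp
    ultimately show ?thesis using that lenX by (simp add: instr_at_def)
  qed
  \<comment> \<open>Behind the short block all action positions are shifted by one.\<close>
  define f where "f j = (if j \<le> m then 3 * j else 3 * j - 1)" for j
  have L: "block_layout X f M"
    unfolding block_layout_def
  proof (intro conjI allI impI)
    show "f 0 = 0" by (simp add: f_def)
    have fM: "f M + 1 = 3 * M" using m M by (auto simp: f_def)
    then show "length X = f M + 1" using lenX by simp
    have "X = (seqs 1 m P @ R @ seqs (m + 1) (M - 1) Q) @ [Halt]" using X' by simp
    then have "X ! (length X - 1) = Halt" by (metis last_conv_nth last_snoc snoc_eq_iff_butlast)
    then show "instr_at X (f M + 1) Halt" using lenX fM M by (simp add: instr_at_def)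
    fix j assume j: "j < M"
    consider "j < m" | "j = m" | "m < j" by linarith
    then show "(f (Suc j) = f j + 3 \<and> (\<exists>a. instr_at X (f j + 1) (Neg (InGet a))) \<and>
        (\<exists>b. instr_at X (f j + 2) (Pos (InGet b)))) \<or>
      (f (Suc j) = f j + 2 \<and> (\<exists>a. instr_at X (f j + 1) (Pos (InGet a))))"
    proof cases
      case 1
      then show ?thesis using atP[of j 0] atP[of j 1] by (auto simp: f_def P_def)
    next
      case 2
      then show ?thesis using atR[of 0] by (auto simp: f_def R_def)
    next
      case 3
      have "f j + 1 = 3 * j" "f j + 2 = 3 * j + 1" "f (Suc j) = f j + 3" using 3 by (auto simp: f_def)
      then show ?thesis using atQ[of j 0] atQ[of j 1] 3 j by (auto simp: Q_def)
    qed
  qed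
  have at\<phi>: "instr_at X (f j) (\<phi> j)" if j: "j \<in> {1..M}" for j
  proof -
    consider "j \<le> m" | "j = Suc m" | "Suc m < j" by linarith
    then show ?thesis
    proof cases
      case 1
      then show ?thesis using atP[of "j - 1" 2] j by (cases j) (auto simp: f_def P_def eval_nat_numeral)
    next
      case 2
      then show ?thesis using atR[of 1] by (simp add: f_def R_def)
    next
      case 3
      moreover have "3 * (j - 1) + 2 = 3 * j - 1" using 3 by simp
      ultimately show ?thesis using atQ[of "j - 1" 2] j by (simp add: f_def Q_def)
    qed
  qed
  have A: "block_action X f M j" if j: "j \<in> {1..M}" for j
  proof -
    consider (jump1) k where "\<phi> j = Jump (3 * k - 1)" "k \<ge> 1" "k \<le> M - j" "j \<le> m" "m < j + k"
      | (jump2) k where "\<phi> j = Jump (3 * k)" "k \<ge> 1" "k \<le> M - j" "\<not> (j \<le> m \<and> m < j + k)"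
      | (plain) "\<phi> j = Plain (OutSet True)" | (pos) "\<phi> j = Pos (OutSet True)"
      | (neg) "\<phi> j = Neg (OutSet True)" using \<phi>[OF j] by blast
    then show ?thesis
    proof cases
      case jump1
      then have "f (j + k) - f j = 3 * k - 1" by (simp add: f_def)
      then show ?thesis using at\<phi>[OF j] j jump1 unfolding block_action_def
        by (intro disjI1 exI[of _ "j + k"]) auto
    next
      case jump2
      then have "f (j + k) - f j = 3 * k" using j by (auto simp: f_def)
      then show ?thesis using at\<phi>[OF j] j jump2 unfolding block_action_def
        by (intro disjI1 exI[of _ "j + k"]) auto
    next
      case neg
      then have "j < M" using \<phi>M j by (cases "j = M") auto
      then show ?thesis using at\<phi>[OF j] neg by (simp add: block_action_def)
    qed (use at\<phi>[OF j] in \<open>simp_all add: block_action_def\<close>)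
  qed
  have \<phi>_no_read: "\<not> reads a (\<phi> j)" if "j \<in> {1..M}" for a j
    using \<phi>[OF that] by (auto simp: reads_def)
  have "{a. \<exists>u\<in>set X. reads a u} = \<rho> ` {1..n}"
  proof (intro set_eqI iffI)
    fix a assume "a \<in> {a. \<exists>u\<in>set X. reads a u}"
    then obtain u where u: "u \<in> set X" "reads a u" by blast
    have "\<exists>c\<in>{1..n}. a = \<rho> c"
    proof -
      consider (P) j where "j \<in> {1..m}" "u \<in> set (P j)" | (R) "u \<in> set R"
        | (Q) j where "j \<in> {m + 1..M - 1}" "u \<in> set (Q j)"
        using u by (auto simp: X' set_seqs reads_def)
      then show ?thesis
      proof cases
        case P
        have "\<not> reads a (\<phi> j)" by (rule \<phi>_no_read) (use P m M in auto)
        then have "a = \<rho> (2 * j - 1) \<or> a = \<rho> (2 * j)"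
          using u P by (auto simp: P_def reads_def)
        moreover have "2 * j - 1 \<in> {1..n}" "2 * j \<in> {1..n}" using P M m by auto
        ultimately show ?thesis by blast
      next
        case R
        have "\<not> reads a (\<phi> (m + 1))" by (rule \<phi>_no_read) (use R m M in auto)
        then have "a = \<rho> (2 * m + 1)"
          using u R by (auto simp: R_def reads_def)
        moreover have "2 * m + 1 \<in> {1..n}" using M m by auto
        ultimately show ?thesis by blast
      next
        case Q
        have "\<not> reads a (\<phi> (j + 1))" by (rule \<phi>_no_read) (use Q m M in auto)
        then have "a = \<rho> (2 * j) \<or> a = \<rho> (2 * j + 1)"
          using u Q by (auto simp: Q_def reads_def)
        moreover have "2 * j \<in> {1..n}" "2 * j + 1 \<in> {1..n}" using Q M m by auto
        ultimately show ?thesis by blast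
      qed
    qed
    then show "a \<in> \<rho> ` {1..n}" by blast
  next
    fix a assume "a \<in> \<rho> ` {1..n}"
    then obtain c where c: "a = \<rho> c" "c \<in> {1..n}" by blast
    have "\<exists>u\<in>set X. u = Neg (InGet a) \<or> u = Pos (InGet a)"
    proof -
      consider (P) "c \<le> 2 * m" | (R) "c = 2 * m + 1" | (Q) "c > 2 * m + 1" by linarith
      then show ?thesis
      proof cases
        case P
        define j where "j = (c + 1) div 2"
        have j: "j \<in> {1..m}" "c = 2 * j - 1 \<or> c = 2 * j" using c P unfolding j_def by auto
        then have "\<exists>u\<in>set (P j). u = Neg (InGet a) \<or> u = Pos (InGet a)"
          using c by (auto simp: P_def)
        then show ?thesis using j(1) by (auto simp: X' set_seqs)
      next
        case R
        then show ?thesis using c by (auto simp: X' R_def)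
      next
        case Q
        \<comment> \<open>Behind the single test the pairs are \<open>2 * j\<close> and
          \<open>2 * j + 1\<close>, so the rounding differs from the case before it.\<close>
        define j where "j = c div 2"
        have j: "j \<in> {m + 1..M - 1}" "c = 2 * j \<or> c = 2 * j + 1"
          using c Q M unfolding j_def by auto
        then have "\<exists>u\<in>set (Q j). u = Neg (InGet a) \<or> u = Pos (InGet a)"
          using c by (auto simp: Q_def)
        then show ?thesis using j(1) by (auto simp: X' set_seqs)
      qed
    qed
    then show "a \<in> {a. \<exists>u\<in>set X. reads a u}" by (auto simp: reads_def)
  qed
  then have "{a. \<exists>u\<in>set X. reads a u} = {1..n}" using \<rho> by (simp add: bij_betw_def)
  then show ?thesis using L A by blast
qed

lemma C_class_layout:
  assumes "n \<ge> 1" "X \<in> C_class n"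
  obtains f M where "block_layout X f M" "\<And>j. 1 \<le> j \<Longrightarrow> j \<le> M \<Longrightarrow> block_action X f M j"
    "{a. \<exists>u\<in>set X. reads a u} = {1..n}"
proof -
  have "\<exists>f M. block_layout X f M \<and> (\<forall>j\<in>{1..M}. block_action X f M j) \<and>
    {a. \<exists>u\<in>set X. reads a u} = {1..n}"
  proof (cases "even n")
    case True
    then show ?thesis using C_even_layout assms by (simp add: C_class_def)
  next
    case False
    then show ?thesis using C_odd_layout assms by (simp add: C_class_def)
  qed
  then show ?thesis using that by (meson atLeastAtMost_iff)
qed

section \<open>Correctness without and with a repeated read\<close>

lemma C_class_computes:
  assumes "n \<ge> 1" "X \<in> C_class n"
  shows "computes n X (tstnz n)"
proof -
  obtain f M where fM: "block_layout X f M" "\<And>j. 1 \<le> j \<Longrightarrow> j \<le> M \<Longrightarrow> block_action X f M j"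
    "{a. \<exists>u\<in>set X. reads a u} = {1..n}"
    using C_class_layout[OF assms] by blast
  \<comment> \<open>With \<open>T\<close> empty and \<open>k\<close> beyond \<open>f M\<close>, the
    assumptions on the two reads hold vacuously; register 0 is a dummy.\<close>
  interpret reading_program X f M "{}" 0 "f M + 1"
    by unfold_locales (use fM in auto)
  show ?thesis using computes_tstnz[OF fM(3)] by simp
qed

lemma instr_at_update:
  assumes "1 \<le> l" "l \<le> length X"
  shows "instr_at (X[l - 1 := v]) p u \<longleftrightarrow> (if p = l then u = v else instr_at X p u)"
  using assms by (auto simp: instr_at_def nth_list_update)

text \<open>The program with \<open>Jump 2\<close> at position \<open>l\<close> has a block layout.
  That layout carries over to \<open>X\<close>, where the action at \<open>l\<close> becomes the
  second read of \<open>In i\<close>.\<close>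

lemma twice_read_computes:
  assumes n: "n \<ge> 1" and "k \<noteq> l" and u: "instr_at X k u" "reads i u"
    and v: "instr_at X l (Pos (InGet i))"
    and nochain: "\<And>p. p \<le> k + 2 \<Longrightarrow> \<not> jump_chain X p l"
    and C: "X[l - 1 := Jump 2] \<in> C_class n"
  shows "computes n X (tstnz n)"
proof -
  define Y where "Y = X[l - 1 := Jump 2]"
  obtain f M where L: "block_layout Y f M"
    and A: "\<And>j. 1 \<le> j \<Longrightarrow> j \<le> M \<Longrightarrow> block_action Y f M j"
    and R: "{a. \<exists>u\<in>set Y. reads a u} = {1..n}"
    using C_class_layout[OF n C] unfolding Y_def by blast
  have l: "1 \<le> l" "l \<le> length X" using v by (auto simp: instr_at_def)
  have at_Y: "instr_at Y p w \<longleftrightarrow> (if p = l then w = Jump 2 else instr_at X p w)" for p w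
    unfolding Y_def by (rule instr_at_update[OF l])
  have lenY: "length Y = length X" by (simp add: Y_def)
  have "l \<noteq> f M + 1" using L at_Y[of "f M + 1"] by (auto simp: block_layout_def)
  then have "l \<le> f M" using l lenY L by (simp add: block_layout_def)
  then obtain j0 where j0: "j0 < M" "f j0 < l" "l \<le> f (Suc j0)"
    using block_layout_cover[of f l M] l L by (auto simp: block_layout_def)
  \<comment> \<open>Inside a block, before its action, only reads occur, whereas \<open>Y\<close>
    has a jump at \<open>l\<close>.\<close>
  have l_eq: "l = f (Suc j0)"
  proof (rule ccontr)
    assume "l \<noteq> f (Suc j0)"
    then have "l < f (Suc j0)" using j0 by simp
    then have "l = f j0 + 1 \<or> (l = f j0 + 2 \<and> f (Suc j0) = f j0 + 3)"
      using L j0 unfolding block_layout_def by fastforce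
    then have "\<exists>a. instr_at Y l (Neg (InGet a)) \<or> instr_at Y l (Pos (InGet a))"
      using L j0(1) unfolding block_layout_def by fastforce
    then show False using at_Y by auto
  qed
  define j1 where "j1 = Suc j0"
  have j1: "1 \<le> j1" "j1 \<le> M" "l = f j1" using j0 l_eq by (auto simp: j1_def)
  obtain j' where j': "j1 < j'" "j' \<le> M" "f j' - f j1 = 2"
    using A[OF j1(1,2)] at_Y[of l] j1 unfolding block_action_def by auto
  \<comment> \<open>Two or more blocks would span at least 4 positions.\<close>
  have "j' = Suc j1" using block_layout_less[OF L j'(1,2)] j' by simp
  then have two: "j1 < M" "f (Suc j1) = f j1 + 2" using j' by auto
  define T where "T = {p. jump_chain X p l}"
  have f_inj: "j = j1" if "f j = l" "j \<le> M" for j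
    using that j1 block_layout_less[OF L, of j j1] block_layout_less[OF L, of j1 j]
    by (cases j j1 rule: linorder_cases) auto
  interpret reading_program X f M T i k
  proof
    have get: "instr_at X p w" if "instr_at Y p w" "w \<noteq> Jump 2" for p w
      using that at_Y by (auto split: if_splits)
    show "block_layout X f M"
      using L unfolding block_layout_def lenY by (meson get instr.distinct)
  next
    fix j assume j: "1 \<le> j" "j \<le> M"
    show "block_action X f M j \<or>
      (f j \<in> T \<and> instr_at X (f j) (Pos (InGet i)) \<and> j < M \<and> f (Suc j) = f j + 2)"
    proof (cases "j = j1")
      case True
      \<comment> \<open>The chain of length zero puts \<open>l\<close> itself into
        \<open>T\<close>.\<close>
      then show ?thesis using two v j1 by (simp add: T_def jump_chain_def)
    next
      case False
      then have "f j \<noteq> l" using f_inj j by blast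
      then show ?thesis using A[OF j] at_Y unfolding block_action_def by simp
    qed
  next
    fix p m assume "instr_at X p (Jump m)" "1 \<le> m" "p + m \<in> T"
    then have "jump_step X p (p + m)" "jump_chain X (p + m) l" by (auto simp: jump_step_def T_def)
    then show "p \<in> T"
      unfolding T_def jump_chain_def by (simp add: converse_rtranclp_into_rtranclp)
  next
    show "k + 2 < p" if "p \<in> T" for p
      using that nochain[of p] by (force simp: T_def)
  next
    show "instr_at X k (Pos (InGet i)) \<or> instr_at X k (Neg (InGet i))"
      using u by (auto simp: reads_def)
  qed
  have "(\<exists>w\<in>set X. reads a w) \<longleftrightarrow> (\<exists>p w. instr_at X p w \<and> reads a w)" for a X
    by (rule ex_reads_iff)
  \<comment> \<open>Replacing the read at \<open>l\<close> by a jump loses no register, since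
    \<open>In i\<close> is still read at \<open>k\<close>.\<close>
  moreover have "(\<exists>p w. instr_at X p w \<and> reads a w) \<longleftrightarrow> (\<exists>p w. instr_at Y p w \<and> reads a w)" for a
  proof
    assume "\<exists>p w. instr_at Y p w \<and> reads a w"
    then show "\<exists>p w. instr_at X p w \<and> reads a w"
      by (auto simp: at_Y reads_def split: if_splits)
  next
    assume "\<exists>p w. instr_at X p w \<and> reads a w"
    then obtain p w where pw: "instr_at X p w" "reads a w" by blast
    show "\<exists>p w. instr_at Y p w \<and> reads a w"
    proof (cases "p = l")
      case True
      then have "a = i" using pw v by (auto simp: reads_def dest: instr_at_unique)
      then show ?thesis using u \<open>k \<noteq> l\<close> at_Y by auto
    next
      case False
      then show ?thesis using pw at_Y by auto
    qed
  qed
  ultimately have "{a. \<exists>w\<in>set X. reads a w} = {1..n}" using R by simp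
  then show ?thesis using computes_tstnz u by (simp add: instr_at_def)
qed

theorem theorem3:
  fixes n :: nat and X :: "instr list"
  assumes "n \<ge> 1" and "X \<in> IS" and "X \<in> E_class n"
  shows "computes n X (tstnz n)"
proof -
  consider "X \<in> C_class n"
    | i k l u v i' where "k \<noteq> l" "instr_at X k u" "reads i u" "instr_at X l v" "reads i v"
      "\<not> (\<exists>p\<le>k + 2. jump_chain X p l)" "v = Pos (InGet i')" "X[l - 1 := Jump 2] \<in> C_class n"
    using assms(3) unfolding E_class_def by blast
  then show ?thesis
  proof cases
    case 1
    then show ?thesis using C_class_computes assms(1) by blast
  next
    case 2
    then have "i' = i" by (auto simp: reads_def)
    then show ?thesis using twice_read_computes[OF assms(1) 2(1-3)] 2 by blast
  qed
qed

end
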